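(* Let $G$ be a finite simple undirected graph with $n \geq 1$ vertices and $m$ edges. Let $\rho(G)$ be its spectral radius and let $s(G)=\sum_{u\in V(G)}\left|d(u)-\frac{2m}{n}\right|$ be its degree deviation, where $d(u)$ is the degree of the vertex $u$ in $G$. Then $$\rho(G)-\frac{2m}{n}\leq\sqrt{\frac{1}{2}\,s(G)}.$$
   Context: All graphs are finite, undirected, and without loops or multiple edges. $V(G)$ denotes the vertex set of $G$. The adjacency matrix $A(G)=(a_{ij})$ of $G$ is the $n\times n$ matrix indexed by the vertices of $G$, with $a_{ij}=1$ if $i$ is adjacent to $j$ in $G$ and $a_{ij}=0$ otherwise. The spectral radius $\rho(G)$ is the largest eigenvalue of $A(G)$. *)

theory Defs
  imports "HOL-Analysis.Analysis"
begin

text \<open>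
  A graph on the finite nonempty vertex type \<^typ>\<open>'v\<close> (so \<open>V(G) = UNIV\<close>) is given by its set of
  edges. An edge is an unordered pair of distinct vertices, i.e. a two-element set, so loops and
  multiple edges are excluded.
\<close>

definition simple_graph :: "'v::finite set set \<Rightarrow> bool" where
  "simple_graph E \<longleftrightarrow> (\<forall>e\<in>E. card e = 2)"

definition degree :: "'v::finite set set \<Rightarrow> 'v \<Rightarrow> nat" where
  "degree E u = card {v. {u, v} \<in> E}"

definition adjacency_matrix :: "'v::finite set set \<Rightarrow> real ^ 'v ^ 'v" where
  "adjacency_matrix E = (\<chi> i j. if {i, j} \<in> E then 1 else 0)"

definition eigenvalue :: "real ^ 'n ^ 'n \<Rightarrow> real \<Rightarrow> bool" where
  "eigenvalue A k \<longleftrightarrow> (\<exists>x. x \<noteq> 0 \<and> A *v x = k *\<^sub>R x)"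

text \<open>
  The maximum below is over a finite nonempty set (see \<open>finite_eigenvalues\<close> and
  \<open>eigenvalue_exists\<close>), since the adjacency matrix is real symmetric.
\<close>

definition spectral_radius :: "'v::finite set set \<Rightarrow> real" where
  "spectral_radius E = Max {k. eigenvalue (adjacency_matrix E) k}"

definition degree_deviation :: "'v::finite set set \<Rightarrow> real" where
  "degree_deviation E = (\<Sum>u\<in>UNIV. \<bar>real (degree E u) - 2 * real (card E) / real CARD('v)\<bar>)"

lemma transpose_adjacency_matrix: "transpose (adjacency_matrix E) = adjacency_matrix E"
  by (simp add: transpose_def adjacency_matrix_def vec_eq_iff insert_commute)

lemma symmetric_inner:
  fixes A :: "real ^ 'n ^ 'n"
  assumes "transpose A = A"
  shows "inner (A *v x) y = inner x (A *v y)"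
  by (metis assms dot_lmul_matrix vector_transpose_matrix)

lemma finite_eigenvalues:
  fixes A :: "real ^ 'n ^ 'n"
  assumes sym: "transpose A = A"
  shows "finite {k. eigenvalue A k}"
proof -
  define ev where "ev k = (SOME x. x \<noteq> 0 \<and> A *v x = k *\<^sub>R x)" for k
  have ev: "ev k \<noteq> 0 \<and> A *v ev k = k *\<^sub>R ev k" if "eigenvalue A k" for k
    using that unfolding eigenvalue_def ev_def by (rule someI_ex)
  have orth: "orthogonal (ev k) (ev l)" if "eigenvalue A k" "eigenvalue A l" "k \<noteq> l" for k l
  proof -
    have "k * inner (ev k) (ev l) = l * inner (ev k) (ev l)"
      using symmetric_inner[OF sym, of "ev k" "ev l"] ev[OF that(1)] ev[OF that(2)] by simp
    with that(3) show ?thesis by (simp add: orthogonal_def)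
  qed
  have "inj_on ev {k. eigenvalue A k}"
  proof (rule inj_onI)
    fix k l
    assume "k \<in> {k. eigenvalue A k}" "l \<in> {k. eigenvalue A k}" "ev k = ev l"
    then show "k = l"
      using orth[of k l] ev[of k] by (auto simp: orthogonal_self)
  qed
  moreover have "finite (ev ` {k. eigenvalue A k})"
    by (rule pairwise_orthogonal_imp_finite) (use orth in \<open>auto simp: pairwise_def\<close>)
  ultimately show ?thesis by (rule finite_imageD[rotated])
qed

lemma eigenvalue_exists:
  fixes A :: "real ^ 'n ^ 'n"
  assumes sym: "transpose A = A"
  shows "\<exists>k. eigenvalue A k"
proof -
  let ?S = "sphere (0 :: real ^ 'n) 1"
  have "compact ?S" "?S \<noteq> {}" by auto
  moreover have "continuous_on ?S (\<lambda>x. inner x (A *v x))"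
    by (intro continuous_intros matrix_vector_mult_linear_continuous_on)
  ultimately obtain x where x: "x \<in> ?S" and
    max: "\<And>y. y \<in> ?S \<Longrightarrow> inner y (A *v y) \<le> inner x (A *v x)"
    using continuous_attains_sup[of ?S "\<lambda>x. inner x (A *v x)"] by blast
  define k where "k = inner x (A *v x)"
  define B where "B y = k *\<^sub>R y - A *v y" for y
  have nx: "norm x = 1" using x by simp
  have B_add: "B (y + t *\<^sub>R z) = B y + t *\<^sub>R B z" for y z t
    by (simp add: B_def matrix_vector_right_distrib matrix_vector_mult_scaleR algebra_simps)
  have B_sym: "inner (B y) z = inner y (B z)" for y z
    by (simp add: B_def inner_diff_left inner_diff_right symmetric_inner[OF sym])
  have psd: "inner y (B y) \<ge> 0" for y
  proof (cases "y = 0")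
    case False
    define u where "u = (1 / norm y) *\<^sub>R y"
    have y: "y = norm y *\<^sub>R u" and "u \<in> ?S" using False by (auto simp: u_def)
    then have "inner u (A *v u) \<le> k" using max by (simp add: k_def)
    moreover have "inner u u = 1" using \<open>u \<in> ?S\<close> by (simp add: dot_square_norm)
    ultimately have "inner u (B u) \<ge> 0" by (simp add: B_def inner_diff_right)
    moreover have "inner y (B y) = (norm y)\<^sup>2 * inner u (B u)"
      by (subst (1 2) y) (simp add: B_def matrix_vector_mult_scaleR inner_diff_right
            algebra_simps power2_eq_square)
    ultimately show ?thesis by simp
  qed simp
  have zero: "inner x (B x) = 0"
    using nx by (simp add: B_def inner_diff_right dot_square_norm k_def)
  have "B x = 0"
  proof (rule ccontr)
    assume "B x \<noteq> 0"
    define w where "w = B x"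
    define p where "p = inner w w"
    define q where "q = inner w (B w)"
    define t where "t = - p / (q + 1)"
    have "p > 0" using \<open>B x \<noteq> 0\<close> by (simp add: p_def w_def)
    have "q \<ge> 0" using psd by (simp add: q_def)
    have "inner x (B w) = p" by (simp add: p_def w_def B_sym[symmetric])
    then have "inner (x + t *\<^sub>R w) (B (x + t *\<^sub>R w)) = 2 * t * p + t\<^sup>2 * q"
      using zero unfolding B_add
      by (simp add: inner_add_left inner_add_right w_def[symmetric] p_def q_def power2_eq_square
          algebra_simps)
    also have "\<dots> = - p * p * (q + 2) / (q + 1)\<^sup>2"
      using \<open>q \<ge> 0\<close> by (simp add: t_def divide_simps power2_eq_square) (simp add: algebra_simps)
    also have "\<dots> < 0" using \<open>p > 0\<close> \<open>q \<ge> 0\<close> by (simp add: divide_neg_pos)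
    finally show False using psd[of "x + t *\<^sub>R w"] by simp
  qed
  then have "A *v x = k *\<^sub>R x" by (simp add: B_def)
  moreover have "x \<noteq> 0" using nx by auto
  ultimately show ?thesis unfolding eigenvalue_def by blast
qed

end

theory Submission
  imports Defs
begin

text \<open>
  Write \<open>t = 2m/n\<close>, let \<open>e\<^sub>u = max 0 (d(u) - t)\<close> be the excess of the vertex \<open>u\<close>, and let
  \<open>S\<close> be the total excess. The deviations \<open>d(u) - t\<close> add up to zero by the handshake lemma, so
  \<open>S\<close> is exactly half the degree deviation, and the claim reads \<open>\<rho> \<le> t + \<surd>S\<close>.

  An eigenvalue of a nonnegative matrix \<open>A\<close> is bounded by any \<open>c\<close> for which some positive vector \<open>y\<close>
  satisfies \<open>A y \<le> c y\<close> (\<open>eigenvalue_le_Collatz_Wielandt\<close>). For \<open>\<sigma> > 0\<close> with \<open>\<sigma>\<^sup>2 \<ge> S\<close> the vector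
  \<open>y\<^sub>u = \<sigma> + e\<^sub>u\<close> does this with \<open>c = t + \<sigma>\<close>: the constant part contributes
  \<open>\<sigma> d(u) \<le> \<sigma> (t + e\<^sub>u)\<close> to \<open>(A y)\<^sub>u\<close>, and the excesses of the neighbours contribute at most the
  total excess \<open>S \<le> \<sigma>\<^sup>2\<close>, whence
  \<open>(A y)\<^sub>u \<le> \<sigma> (t + e\<^sub>u) + \<sigma>\<^sup>2 \<le> (t + \<sigma>) (\<sigma> + e\<^sub>u)\<close>.
  Letting \<open>\<sigma>\<close> decrease to \<open>\<surd>S\<close> gives the theorem; the limit covers the regular case \<open>S = 0\<close>,
  where \<open>\<sigma> = \<surd>S\<close> would give \<open>y = 0\<close>.
\<close>

text \<open>
  This is the easy half of the Collatz--Wielandt characterisation: compare both sides of the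
  eigenvalue equation at a coordinate where \<open>\<bar>x\<^sub>i\<bar> / y\<^sub>i\<close> is largest.
\<close>

lemma eigenvalue_le_Collatz_Wielandt:
  fixes A :: "real ^ 'n ^ 'n" and y :: "real ^ 'n"
  assumes "eigenvalue A k"
    and nonneg: "\<And>i j. A $ i $ j \<ge> 0"
    and pos: "\<And>i. y $ i > 0"
    and le: "\<And>i. (A *v y) $ i \<le> c * y $ i"
  shows "k \<le> c"
proof -
  obtain x where "x \<noteq> 0" and x: "A *v x = k *\<^sub>R x"
    using assms(1) unfolding eigenvalue_def by blast
  let ?R = "range (\<lambda>i. \<bar>x $ i\<bar> / y $ i)"
  have "Max ?R \<in> ?R"
    by (intro Max_in) auto
  then obtain u where "Max ?R = \<bar>x $ u\<bar> / y $ u"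
    by blast
  then have u: "\<bar>x $ i\<bar> / y $ i \<le> \<bar>x $ u\<bar> / y $ u" for i
    using Max_ge[of ?R "\<bar>x $ i\<bar> / y $ i"] by simp
  define r where "r = \<bar>x $ u\<bar> / y $ u"
  have x_le: "\<bar>x $ i\<bar> \<le> r * y $ i" for i
    using u[of i] pos[of i] by (simp add: r_def pos_divide_le_eq)
  have xu: "\<bar>x $ u\<bar> = r * y $ u"
    using pos[of u] by (simp add: r_def)
  obtain j where "x $ j \<noteq> 0"
    using \<open>x \<noteq> 0\<close> by (auto simp: vec_eq_iff)
  then have "0 < r * y $ j"
    using x_le[of j] by linarith
  then have "r > 0"
    using pos[of j] by (simp add: zero_less_mult_iff)
  have "k * (r * y $ u) \<le> \<bar>k * x $ u\<bar>"
    by (simp add: abs_mult flip: xu) (simp add: mult_right_mono)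
  also have "k * x $ u = (\<Sum>j\<in>UNIV. A $ u $ j * x $ j)"
    using arg_cong[OF x, of "\<lambda>z. z $ u"] by (simp add: matrix_vector_mult_def)
  also have "\<bar>\<dots>\<bar> \<le> (\<Sum>j\<in>UNIV. A $ u $ j * (r * y $ j))"
    using x_le nonneg by (intro order_trans[OF sum_abs] sum_mono) (simp add: abs_mult mult_left_mono)
  also have "\<dots> = r * (A *v y) $ u"
    by (simp add: matrix_vector_mult_def sum_distrib_left mult_ac)
  also have "\<dots> \<le> r * (c * y $ u)"
    using le[of u] \<open>r > 0\<close> by simp
  finally have "k * (r * y $ u) \<le> c * (r * y $ u)"
    by (simp add: mult_ac)
  then show ?thesis
    using \<open>r > 0\<close> pos[of u] by simp
qed

lemma adjacency_matrix_mult_nth: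
  "(adjacency_matrix E *v y) $ u = (\<Sum>v | {u, v} \<in> E. y $ v)"
  by (simp add: matrix_vector_mult_def adjacency_matrix_def sum.If_cases
      if_distrib[of "\<lambda>a. a * _"] cong: if_cong)

text \<open>
  The test vector \<open>y\<^sub>u = \<sigma> + e\<^sub>u\<close> raises the constant vector at the vertices whose degree exceeds
  \<open>t\<close>. The raise pays for the excess of \<open>u\<close> itself, since \<open>\<sigma> e\<^sub>u\<close> appears on both sides, while the
  price seen by the neighbours of raised vertices is bounded crudely by the total raise.
\<close>

lemma eigenvalue_le_threshold_plus_excess:
  fixes E :: "'v::finite set set"
  assumes ev: "eigenvalue (adjacency_matrix E) k"
    and "t \<ge> 0" and "\<sigma> > 0"
    and excess: "(\<Sum>u\<in>UNIV. max 0 (real (degree E u) - t)) \<le> \<sigma>\<^sup>2"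
  shows "k \<le> t + \<sigma>"
proof -
  define e where "e u = max 0 (real (degree E u) - t)" for u
  have e_nonneg: "e u \<ge> 0" for u
    by (simp add: e_def)
  define y where "y = (\<chi> u. \<sigma> + e u)"
  have "(adjacency_matrix E *v y) $ u \<le> (t + \<sigma>) * y $ u" for u
  proof -
    have "(adjacency_matrix E *v y) $ u = \<sigma> * degree E u + (\<Sum>v | {u, v} \<in> E. e v)"
      by (simp add: adjacency_matrix_mult_nth y_def sum.distrib degree_def)
    also have "\<dots> \<le> \<sigma> * (t + e u) + \<sigma>\<^sup>2"
    proof (rule add_mono)
      show "\<sigma> * degree E u \<le> \<sigma> * (t + e u)"
        using \<open>\<sigma> > 0\<close> by (simp add: e_def)
      have "(\<Sum>v | {u, v} \<in> E. e v) \<le> (\<Sum>v\<in>UNIV. e v)"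
        by (intro sum_mono2) (auto simp: e_nonneg)
      also have "\<dots> \<le> \<sigma>\<^sup>2"
        using excess by (simp add: e_def)
      finally show "(\<Sum>v | {u, v} \<in> E. e v) \<le> \<sigma>\<^sup>2" .
    qed
    also have "\<dots> \<le> \<sigma> * (t + e u) + \<sigma>\<^sup>2 + t * e u"
      using \<open>t \<ge> 0\<close> e_nonneg by simp
    also have "\<dots> = (t + \<sigma>) * y $ u"
      by (simp add: y_def algebra_simps power2_eq_square)
    finally show ?thesis .
  qed
  moreover have "y $ u > 0" for u
    using \<open>\<sigma> > 0\<close> e_nonneg[of u] by (simp add: y_def)
  ultimately show ?thesis
    using eigenvalue_le_Collatz_Wielandt[OF ev, of y] by (simp add: adjacency_matrix_def)
qed

lemma degree_eq_card_incident:
  assumes "simple_graph E"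
  shows "degree E u = card {e \<in> E. u \<in> e}"
proof -
  have "bij_betw (\<lambda>v. {u, v}) {v. {u, v} \<in> E} {e \<in> E. u \<in> e}"
    unfolding bij_betw_def
  proof
    show "inj_on (\<lambda>v. {u, v}) {v. {u, v} \<in> E}"
      by (auto simp: inj_on_def doubleton_eq_iff)
    have "\<exists>v. e = {u, v}" if "e \<in> E" "u \<in> e" for e
    proof -
      obtain a b where "e = {a, b}"
        using assms \<open>e \<in> E\<close> by (auto simp: simple_graph_def card_2_iff)
      then show ?thesis
        using \<open>u \<in> e\<close> by (auto simp: insert_commute)
    qed
    then show "(\<lambda>v. {u, v}) ` {v. {u, v} \<in> E} = {e \<in> E. u \<in> e}"
      by auto
  qed
  then show ?thesis
    unfolding degree_def by (rule bij_betw_same_card)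
qed

lemma handshake:
  fixes E :: "'v::finite set set"
  assumes "simple_graph E"
  shows "(\<Sum>u\<in>UNIV. degree E u) = 2 * card E"
proof -
  have "(\<Sum>u\<in>UNIV. card {e \<in> E. u \<in> e}) = 2 * card E"
    using assms by (intro sum_multicount) (auto simp: simple_graph_def)
  then show ?thesis
    using assms by (simp add: degree_eq_card_incident)
qed

lemma total_excess_eq_half_degree_deviation:
  fixes E :: "'v::finite set set"
  assumes "simple_graph E"
  shows "(\<Sum>u\<in>UNIV. max 0 (real (degree E u) - 2 * real (card E) / real CARD('v)))
    = 1 / 2 * degree_deviation E"
proof -
  define t where "t = 2 * real (card E) / real CARD('v)"
  have "(\<Sum>u\<in>UNIV. real (degree E u)) = 2 * real (card E)"
    using handshake[OF assms] by (simp flip: of_nat_sum)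
  then have deviations: "(\<Sum>u\<in>UNIV. real (degree E u) - t) = 0"
    by (simp add: sum_subtractf t_def)
  have "(\<Sum>u\<in>UNIV. max 0 (real (degree E u) - t))
      = (\<Sum>u\<in>UNIV. 1 / 2 * (\<bar>real (degree E u) - t\<bar> + (real (degree E u) - t)))"
    by (rule sum.cong) (auto simp: max_def)
  also have "\<dots> = 1 / 2 * ((\<Sum>u\<in>UNIV. \<bar>real (degree E u) - t\<bar>)
      + (\<Sum>u\<in>UNIV. real (degree E u) - t))"
    by (simp only: sum.distrib flip: sum_distrib_left)
  finally show ?thesis
    using deviations by (simp add: degree_deviation_def t_def)
qed

theorem theorem1p1:
  fixes E :: "'v::finite set set"
  assumes "simple_graph E"
  shows "spectral_radius E - 2 * real (card E) / real CARD('v)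
           \<le> sqrt (1 / 2 * degree_deviation E)"
proof -
  define t where "t = 2 * real (card E) / real CARD('v)"
  define S where "S = 1 / 2 * degree_deviation E"
  have "S \<ge> 0"
    by (simp add: S_def degree_deviation_def sum_nonneg)
  have excess: "(\<Sum>u\<in>UNIV. max 0 (real (degree E u) - t)) = S"
    using total_excess_eq_half_degree_deviation[OF assms] by (simp add: t_def S_def)
  let ?A = "adjacency_matrix E"
  have "spectral_radius E \<in> {k. eigenvalue ?A k}"
    unfolding spectral_radius_def
    using finite_eigenvalues[OF transpose_adjacency_matrix, of E]
      eigenvalue_exists[OF transpose_adjacency_matrix, of E]
    by (intro Max_in) auto
  then have ev: "eigenvalue ?A (spectral_radius E)"
    by simp
  have "spectral_radius E \<le> (t + sqrt S) + \<epsilon>" if "\<epsilon> > 0" for \<epsilon>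
  proof -
    have "S \<le> (sqrt S + \<epsilon>)\<^sup>2"
      using \<open>S \<ge> 0\<close> that power_mono[of "sqrt S" "sqrt S + \<epsilon>" 2] by simp
    moreover have "sqrt S + \<epsilon> > 0"
      using \<open>S \<ge> 0\<close> that by (simp add: add_nonneg_pos)
    moreover have "t \<ge> 0"
      by (simp add: t_def)
    ultimately show ?thesis
      using eigenvalue_le_threshold_plus_excess[OF ev, of t "sqrt S + \<epsilon>"] excess by simp
  qed
  then have "spectral_radius E \<le> t + sqrt S"
    by (rule field_le_epsilon)
  then show ?thesis
    by (simp add: t_def S_def)
qed

end
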